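(* Let $F=(F_1,\dots,F_m):\mathbb{R}^n\to\mathbb{R}^m$ be a convex map (each $F_i$ convex). Define $h:\mathbb{R}\to\mathbb{R}$ by $h(t)=\frac{1}{2-t}$ if $t\le 1$ and $h(t)=t^2$ if $t>1$. Then the function $f:\mathbb{R}^n\times\mathbb{R}^m_+\to\mathbb{R}$ given by $$f(x,z)=\sum_{i=1}^m\big[z_i+h(F_i(x))\big]$$ satisfies properties (P1)–(P4).
   Context: $\mathbb{R}^m_+$ is the set of vectors in $\mathbb{R}^m$ with all components $\ge 0$. Properties of $f:\mathbb{R}^n\times\mathbb{R}^m_+\to\mathbb{R}$ (relative to $F$): (P1) $f$ is bounded below: there is $\alpha\in\mathbb{R}$ with $f(x,z)\ge\alpha$ for all $(x,z)\in\mathbb{R}^n\times\mathbb{R}^m_+$. (P2) $f$ is (jointly) convex on $\mathbb{R}^n\times\mathbb{R}^m_+$. (P3) For all $x,y\in\mathbb{R}^n$ and $z\in\mathbb{R}^m_+$: if $F_i(x)\le F_i(y)$ for all $i=1,\dots,m$ then $f(x,z)\le f(y,z)$; if $F_i(x)<F_i(y)$ for all $i=1,\dots,m$ then $f(x,z)<f(y,z)$. (P4) $f$ is differentiable with respect to $z$ and $\frac{\partial}{\partial z}f(x,z)=g(x,z)$, where $g=(g_1,\dots,g_m)$ is a continuous map on $\mathbb{R}^n\times\mathbb{R}^m_+$ with values in $\mathbb{R}^m_+$. *)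

theory Defs
  imports "HOL-Analysis.Analysis"
begin

definition nonneg_orthant :: "(real ^ 'm) set" where
  "nonneg_orthant = {z. \<forall>i. 0 \<le> z $ i}"

definition convex_map :: "(real ^ 'n \<Rightarrow> real ^ 'm) \<Rightarrow> bool" where
  "convex_map F \<longleftrightarrow> (\<forall>i. convex_on UNIV (\<lambda>x. F x $ i))"

text \<open>
  A function on \<open>UNIV \<times> nonneg_orthant\<close> is represented by a total function on pairs;
  the properties below only constrain its values on \<open>UNIV \<times> nonneg_orthant\<close>.
\<close>

definition P1 :: "((real ^ 'n) \<times> (real ^ 'm) \<Rightarrow> real) \<Rightarrow> bool" where
  "P1 f \<longleftrightarrow> (\<exists>\<alpha>. \<forall>x. \<forall>z\<in>nonneg_orthant. \<alpha> \<le> f (x, z))"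

definition P2 :: "((real ^ 'n) \<times> (real ^ 'm) \<Rightarrow> real) \<Rightarrow> bool" where
  "P2 f \<longleftrightarrow> convex_on (UNIV \<times> nonneg_orthant) f"

definition P3 ::
  "(real ^ 'n \<Rightarrow> real ^ 'm) \<Rightarrow> ((real ^ 'n) \<times> (real ^ 'm) \<Rightarrow> real) \<Rightarrow> bool" where
  "P3 F f \<longleftrightarrow> (\<forall>x y. \<forall>z\<in>nonneg_orthant.
     ((\<forall>i. F x $ i \<le> F y $ i) \<longrightarrow> f (x, z) \<le> f (y, z)) \<and>
     ((\<forall>i. F x $ i < F y $ i) \<longrightarrow> f (x, z) < f (y, z)))"

text \<open>
  Differentiability in \<open>z\<close> is taken within the closed orthant, so that boundary points are
  covered; the orthant is convex with nonempty interior, so the gradient \<open>g (x, z)\<close> is unique.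
\<close>

definition P4 :: "((real ^ 'n) \<times> (real ^ 'm) \<Rightarrow> real) \<Rightarrow> bool" where
  "P4 f \<longleftrightarrow> (\<exists>g :: (real ^ 'n) \<times> (real ^ 'm) \<Rightarrow> real ^ 'm.
     continuous_on (UNIV \<times> nonneg_orthant) g \<and>
     g ` (UNIV \<times> nonneg_orthant) \<subseteq> nonneg_orthant \<and>
     (\<forall>x. \<forall>z\<in>nonneg_orthant.
        ((\<lambda>w. f (x, w)) has_derivative (\<lambda>v. g (x, z) \<bullet> v)) (at z within nonneg_orthant)))"

definition h :: "real \<Rightarrow> real" where
  "h t = (if t \<le> 1 then 1 / (2 - t) else t\<^sup>2)"

end

(* The function h is positive, strictly increasing and convex; convexity of h is shown by exhibiting
   a supporting line at every point, of slope 1/(2-c)^2 for c <= 1 and 2c for c > 1. Hence f is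
   bounded below by 0, and each h (F_i x) is convex as a monotone convex function of a convex one.
   Since f is affine in z, its gradient there is the constant vector (1,...,1). *)
theory Submission
  imports Defs
begin

lemma convex_on_if_supporting_lines:
  fixes f :: "real \<Rightarrow> real"
  assumes "\<And>c. \<exists>m. \<forall>t. f c + m * (t - c) \<le> f t"
  shows "convex_on UNIV f"
proof (rule convex_onI)
  fix t x y :: real
  assume t: "0 < t" "t < 1"
  define c where "c = (1 - t) * x + t * y"
  obtain m where m: "\<And>s. f c + m * (s - c) \<le> f s"
    using assms by blast
  have "f c = (1 - t) * (f c + m * (x - c)) + t * (f c + m * (y - c))"
    by (simp add: c_def algebra_simps)
  also have "\<dots> \<le> (1 - t) * f x + t * f y"
    using t m by (intro add_mono mult_left_mono) auto
  finally show "f ((1 - t) *\<^sub>R x + t *\<^sub>R y) \<le> (1 - t) * f x + t * f y"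
    by (simp add: c_def)
qed simp

lemma h_pos: "0 < h t"
  by (auto simp: h_def)

lemma strict_mono_h: "strict_mono h"
proof (rule strict_monoI)
  fix s t :: real
  assume st: "s < t"
  \<comment> \<open>In the mixed case the value 1 separates the two branches.\<close>
  consider "t \<le> 1" | "s \<le> 1" "1 < t" | "1 < s" by linarith
  then show "h s < h t"
  proof cases
    case 1
    then show ?thesis using st by (simp add: h_def frac_less2)
  next
    case 2
    then have "h s \<le> 1" by (simp add: h_def)
    also have "1 < h t" using 2 by (simp add: h_def)
    finally show ?thesis .
  next
    case 3
    then show ?thesis using st by (simp add: h_def power_strict_mono)
  qed
qed

lemma convex_h: "convex_on UNIV h"
proof (rule convex_on_if_supporting_lines)
  fix c
  show "\<exists>m. \<forall>t. h c + m * (t - c) \<le> h t"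
  proof (cases "c \<le> 1")
    case True
    define u where "u = 1 / (2 - c)"
    have u: "0 < u" "u \<le> 1" "u * (2 - c) = 1"
      using True by (auto simp: u_def)
    \<comment> \<open>The relation \<open>u * (2 - c) = 1\<close> eliminates \<open>c\<close>,
      leaving only \<open>u\<close> and \<open>2 - t\<close>.\<close>
    have tangent: "u + u\<^sup>2 * (t - c) = 2 * u - u\<^sup>2 * (2 - t)" for t
      using u(3) by (simp add: power2_eq_square) algebra
    have line: "u + u\<^sup>2 * (t - c) \<le> h t" for t
    proof (cases "t \<le> 1")
      case t: True
      \<comment> \<open>With \<open>s = u * (2 - t)\<close> the claim, multiplied by
        \<open>2 - t > 0\<close>, is \<open>2 * s - s\<^sup>2 \<le> 1\<close>.\<close>
      have "(2 * u - u\<^sup>2 * (2 - t)) * (2 - t) = 1 - (1 - u * (2 - t))\<^sup>2"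
        by algebra
      also have "\<dots> \<le> 1" by simp
      finally show ?thesis using t by (simp add: tangent h_def pos_le_divide_eq)
    next
      case t: False
      \<comment> \<open>Past the kink the diagonal is an intermediate bound: value and slope of the
        line at 1 are at most 1, so it stays below \<open>t\<close>, and
        \<open>t \<le> t\<^sup>2\<close>.\<close>
      have "2 * u - u\<^sup>2 * (2 - t) = 1 - (1 - u)\<^sup>2 + u\<^sup>2 * (t - 1)"
        by algebra
      also have "\<dots> \<le> 1 + 1 * (t - 1)"
        using t u by (intro add_mono mult_right_mono) (auto simp: power_le_one)
      also have "\<dots> \<le> t\<^sup>2" using t by (simp add: power2_eq_square)
      finally show ?thesis using t by (simp add: tangent h_def)
    qed
    have hc: "h c = u" using True by (simp add: h_def u_def)
    show ?thesis unfolding hc by (intro exI allI) (rule line)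
  next
    case False
    have line: "c\<^sup>2 + 2 * c * (t - c) \<le> h t" for t
    proof (cases "t \<le> 1")
      case True
      \<comment> \<open>The diagonal again separates the line from \<open>h\<close>: both subtracted
        terms are nonnegative since \<open>c > 1\<close> and \<open>t \<le> 1\<close>.\<close>
      have "c\<^sup>2 + 2 * c * (t - c) = t - (c - 1)\<^sup>2 - (2 * c - 1) * (1 - t)"
        by algebra
      also have "\<dots> \<le> t"
        using True False mult_nonneg_nonneg[of "2 * c - 1" "1 - t"] zero_le_power2[of "c - 1"]
        by linarith
      also have "t \<le> 1 / (2 - t)"
      proof -
        have "t * (2 - t) = 1 - (1 - t)\<^sup>2" by algebra
        then show ?thesis using True by (simp add: pos_le_divide_eq)
      qed
      finally show ?thesis using True by (simp add: h_def)
    next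
      case t: False
      have "c\<^sup>2 + 2 * c * (t - c) = t\<^sup>2 - (t - c)\<^sup>2" by algebra
      then show ?thesis using t by (simp add: h_def)
    qed
    have hc: "h c = c\<^sup>2" using False by (simp add: h_def)
    show ?thesis unfolding hc by (intro exI allI) (rule line)
  qed
qed

lemma convex_on_mono_compose:
  fixes g :: "real \<Rightarrow> real"
  assumes "convex_on S f" "convex_on UNIV g" "mono g"
  shows "convex_on S (\<lambda>x. g (f x))"
proof (rule convex_onI)
  show "convex S" using assms(1) by (rule convex_on_imp_convex)
  fix t :: real and x y
  assume t: "0 < t" "t < 1" and xy: "x \<in> S" "y \<in> S"
  have "g (f ((1 - t) *\<^sub>R x + t *\<^sub>R y)) \<le> g ((1 - t) *\<^sub>R f x + t *\<^sub>R f y)"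
    using convex_onD[OF assms(1)] t xy by (intro monoD[OF assms(3)]) simp
  also have "\<dots> \<le> (1 - t) * g (f x) + t * g (f y)"
    using convex_onD[OF assms(2)] t by simp
  finally show "g (f ((1 - t) *\<^sub>R x + t *\<^sub>R y)) \<le> (1 - t) * g (f x) + t * g (f y)" .
qed

lemma convex_nonneg_orthant: "convex nonneg_orthant"
  by (auto simp: convex_def nonneg_orthant_def)

theorem proposition4p1:
  fixes F :: "real ^ 'n \<Rightarrow> real ^ 'm"
    and f :: "(real ^ 'n) \<times> (real ^ 'm) \<Rightarrow> real"
  assumes "convex_map F"
    and "\<And>x z. z \<in> nonneg_orthant \<Longrightarrow> f (x, z) = (\<Sum>i\<in>UNIV. z $ i + h (F x $ i))"
  shows "P1 f \<and> P2 f \<and> P3 F f \<and> P4 f"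
proof (intro conjI)
  have "0 \<le> f (x, z)" if "z \<in> nonneg_orthant" for x z
    using that h_pos
    by (auto simp: assms(2) nonneg_orthant_def less_imp_le intro!: sum_nonneg add_nonneg_nonneg)
  then show "P1 f" unfolding P1_def by blast
  show "P2 f"
    unfolding P2_def
  proof (rule convex_onI)
    show "convex (UNIV \<times> nonneg_orthant :: ((real ^ 'n) \<times> (real ^ 'm)) set)"
      by (intro convex_Times convex_UNIV convex_nonneg_orthant)
    fix t :: real and p q :: "(real ^ 'n) \<times> (real ^ 'm)"
    assume t: "0 < t" "t < 1" and pq: "p \<in> UNIV \<times> nonneg_orthant" "q \<in> UNIV \<times> nonneg_orthant"
    obtain x z y w where p: "p = (x, z)" and q: "q = (y, w)" by fastforce
    have zw: "z \<in> nonneg_orthant" "w \<in> nonneg_orthant" using pq p q by auto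
    \<comment> \<open>The formula for \<open>f\<close> is available only on the orthant, so the
      combined point must be shown to lie there.\<close>
    have mem: "(1 - t) *\<^sub>R z + t *\<^sub>R w \<in> nonneg_orthant"
      using zw t by (intro convexD convex_nonneg_orthant) auto
    have hF: "convex_on UNIV (\<lambda>x. h (F x $ i))" for i
      by (rule convex_on_mono_compose[OF _ convex_h strict_mono_mono[OF strict_mono_h]])
        (use assms(1) in \<open>simp add: convex_map_def\<close>)
    have "h (F ((1 - t) *\<^sub>R x + t *\<^sub>R y) $ i) \<le> (1 - t) * h (F x $ i) + t * h (F y $ i)" for i
      using convex_onD[OF hF] t by simp
    then have "(\<Sum>i\<in>UNIV. ((1 - t) *\<^sub>R z + t *\<^sub>R w) $ i + h (F ((1 - t) *\<^sub>R x + t *\<^sub>R y) $ i))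
      \<le> (\<Sum>i\<in>UNIV. ((1 - t) *\<^sub>R z + t *\<^sub>R w) $ i + ((1 - t) * h (F x $ i) + t * h (F y $ i)))"
      by (intro sum_mono add_left_mono)
    then show "f ((1 - t) *\<^sub>R p + t *\<^sub>R q) \<le> (1 - t) * f p + t * f q"
      using zw mem by (simp add: p q assms(2) sum.distrib sum_distrib_left distrib_left)
  qed
  \<comment> \<open>The strict half needs a nonempty sum; the index type \<open>'m\<close> is
    inhabited, like every HOL type.\<close>
  show "P3 F f"
    unfolding P3_def
    by (auto simp: assms(2) strict_mono_less[OF strict_mono_h] strict_mono_less_eq[OF strict_mono_h]
        intro!: sum_mono sum_strict_mono)
  show "P4 f"
    unfolding P4_def
  proof (intro exI[of _ "\<lambda>_. 1"] conjI allI ballI)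
    fix x and z :: "real ^ 'm"
    assume z: "z \<in> nonneg_orthant"
    have "((\<lambda>w. \<Sum>i\<in>UNIV. w $ i + h (F x $ i)) has_derivative (\<lambda>v. 1 \<bullet> v)) (at z within nonneg_orthant)"
      by (auto intro!: derivative_eq_intros bounded_linear_imp_has_derivative
          bounded_linear_vec_nth simp: inner_vec_def)
    \<comment> \<open>A derivative within the orthant depends only on values there, where
      \<open>f (x, w)\<close> agrees with the sum.\<close>
    then show "((\<lambda>w. f (x, w)) has_derivative (\<lambda>v. 1 \<bullet> v)) (at z within nonneg_orthant)"
      by (rule has_derivative_transform[OF z, rotated]) (simp add: assms(2))
  qed (auto simp: nonneg_orthant_def)
qed

end
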